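(* Let $\mathbb X$ be the set of all rank functions of differential posets. The Interval Property does not hold for $\mathbb X$. More precisely, the two sequences $$\mathbf p':\ 1,4,14,p_3=60,p_4=254,p_5,p_6,\dots$$ and $$\mathbf p'':\ 1,4,17,p_3=60,p_4=254,p_5,p_6,\dots,$$ where $p_i=4p_{i-1}+p_{i-2}$ for all $i\ge 5$, belong to $\mathbb X$, while $$\mathbf p''':\ 1,4,16,p_3=60,p_4=254,p_5,p_6,\dots$$ (with the same $p_i$ for $i\geq 3$) does not.
   Context: Let $r$ be a positive integer and let $P=\bigcup_{n\ge 0}P_n$ be a locally finite graded poset ($P_n$ is the set of elements of rank $n$) with a unique element of rank zero. $P$ is $r$-differential if: (i) two distinct elements $x,y\in P$ cover exactly $k$ common elements if and only if they are covered by exactly $k$ common elements; (ii) an element $x\in P$ covers exactly $m$ elements if and only if it is covered by exactly $m+r$ elements. A differential poset is an $r$-differential poset for some positive integer $r$. Its rank function is the sequence $p_0,p_1,p_2,\dots$ with $p_n=|P_n|$. A set $S$ of integer sequences has the Interval Property if, whenever two sequences in $S$ coincide in all entries but one, say $h=(h_0,\dots,h_{i-1},h_i,h_{i+1},\dots)$ and $h'=(h_0,\dots,h_{i-1},h_i+\alpha,h_{i+1},\dots)$ for some index $i$ and some positive integer $\alpha$, then the sequence $(h_0,\dots,h_{i-1},h_i+\beta,h_{i+1},\dots)$ is also in $S$ for each $\beta=0,1,\dots,\alpha$. *)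

theory Defs
  imports Complex_Main "HOL-Library.Countable_Set"
begin

text \<open>
  A poset is a carrier \<open>P\<close> with an order relation \<open>r\<close>, where \<open>(x, y) \<in> r\<close> means \<open>x \<le> y\<close>.
\<close>

text \<open>\<open>covers r x y\<close>: the element \<open>x\<close> covers the element \<open>y\<close>.\<close>

definition covers :: "'a rel \<Rightarrow> 'a \<Rightarrow> 'a \<Rightarrow> bool" where
  "covers r x y \<longleftrightarrow> (y, x) \<in> r \<and> y \<noteq> x \<and> (\<forall>z. (y, z) \<in> r \<and> (z, x) \<in> r \<longrightarrow> z = y \<or> z = x)"

definition locally_finite :: "'a set \<Rightarrow> 'a rel \<Rightarrow> bool" where
  "locally_finite P r \<longleftrightarrow> (\<forall>x\<in>P. \<forall>y\<in>P. finite {z \<in> P. (x, z) \<in> r \<and> (z, y) \<in> r})"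

definition graded_by :: "'a set \<Rightarrow> 'a rel \<Rightarrow> ('a \<Rightarrow> nat) \<Rightarrow> bool" where
  "graded_by P r \<rho> \<longleftrightarrow>
     (\<forall>x\<in>P. (\<forall>y\<in>P. (y, x) \<in> r \<longrightarrow> y = x) \<longrightarrow> \<rho> x = 0) \<and>
     (\<forall>x\<in>P. \<forall>y\<in>P. covers r x y \<longrightarrow> \<rho> x = Suc (\<rho> y))"

text \<open>The finiteness conjunct is needed because \<open>card\<close> is \<open>0\<close> on infinite sets.\<close>

definition has_exactly :: "'a set \<Rightarrow> nat \<Rightarrow> bool" where
  "has_exactly A k \<longleftrightarrow> finite A \<and> card A = k"

definition differential_poset :: "nat \<Rightarrow> 'a set \<Rightarrow> 'a rel \<Rightarrow> ('a \<Rightarrow> nat) \<Rightarrow> bool" where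
  "differential_poset d P r \<rho> \<longleftrightarrow>
     d > 0 \<and> partial_order_on P r \<and> locally_finite P r \<and> graded_by P r \<rho> \<and>
     (\<exists>!x. x \<in> P \<and> \<rho> x = 0) \<and>
     (\<forall>x\<in>P. \<forall>y\<in>P. x \<noteq> y \<longrightarrow> (\<forall>k.
        has_exactly {z \<in> P. covers r x z \<and> covers r y z} k \<longleftrightarrow>
        has_exactly {z \<in> P. covers r z x \<and> covers r z y} k)) \<and>
     (\<forall>x\<in>P. \<forall>m.
        has_exactly {z \<in> P. covers r x z} m \<longleftrightarrow> has_exactly {z \<in> P. covers r z x} (m + d))"

definition rank_sizes :: "'a set \<Rightarrow> ('a \<Rightarrow> nat) \<Rightarrow> nat \<Rightarrow> int" where
  "rank_sizes P \<rho> n = int (card {x \<in> P. \<rho> x = n})"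

text \<open>
  Since one cannot quantify over types, the elements are taken to be natural numbers. This loses
  nothing: differential posets are countable, and \<open>rank_sizes_in_differential_rank_functions\<close>
  below shows that the set contains the rank function of every differential poset on any type.
\<close>

definition differential_rank_functions :: "(nat \<Rightarrow> int) set" where
  "differential_rank_functions =
     {h. \<exists>d (P :: nat set) r \<rho>. differential_poset d P r \<rho> \<and> h = rank_sizes P \<rho>}"

definition interval_property :: "(nat \<Rightarrow> int) set \<Rightarrow> bool" where
  "interval_property S \<longleftrightarrow>
     (\<forall>h i \<alpha>. \<alpha> > 0 \<and> h \<in> S \<and> h(i := h i + \<alpha>) \<in> S \<longrightarrow>
        (\<forall>\<beta>\<in>{0..\<alpha>}. h(i := h i + \<beta>) \<in> S))"

text \<open>The sequence \<open>1, 4, c, 60, 254, \<dots>\<close> with \<open>p\<^sub>i = 4 p\<^sub>i\<^sub>-\<^sub>1 + p\<^sub>i\<^sub>-\<^sub>2\<close> for \<open>i \<ge> 5\<close>.\<close>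

fun seq60 :: "int \<Rightarrow> nat \<Rightarrow> int" where
  "seq60 c 0 = 1"
| "seq60 c (Suc 0) = 4"
| "seq60 c (Suc (Suc 0)) = c"
| "seq60 c (Suc (Suc (Suc 0))) = 60"
| "seq60 c (Suc (Suc (Suc (Suc 0)))) = 254"
| "seq60 c (Suc (Suc (Suc (Suc (Suc n))))) =
     4 * seq60 c (Suc (Suc (Suc (Suc n)))) + seq60 c (Suc (Suc (Suc n)))"

lemma seq60_values:
  "seq60 c 0 = 1" "seq60 c 1 = 4" "seq60 c 2 = c" "seq60 c 3 = 60" "seq60 c 4 = 254"
  by (simp_all add: eval_nat_numeral)

lemma seq60_rec:
  assumes "i \<ge> 5"
  shows "seq60 c i = 4 * seq60 c (i - 1) + seq60 c (i - 2)"
proof -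
  obtain n where "i = Suc (Suc (Suc (Suc (Suc n))))"
    using that[of "i - 5"] assms by simp
  then show ?thesis by simp
qed

lemma differential_poset_exists_covered:
  assumes D: "differential_poset d P r \<rho>" and x: "x \<in> P" "\<rho> x = Suc n"
  shows "\<exists>y\<in>P. covers r x y \<and> \<rho> y = n"
proof -
  have po: "r \<subseteq> P \<times> P" "refl_on P r" "trans r" "antisym r"
    and lf: "locally_finite P r" and gr: "graded_by P r \<rho>"
    using D by (auto simp: differential_poset_def partial_order_on_def preorder_on_def)
  obtain y where y: "y \<in> P" "(y, x) \<in> r" "y \<noteq> x"
    using gr x by (force simp: graded_by_def)
  define A where "A = {z \<in> P. (y, z) \<in> r \<and> (z, x) \<in> r} - {x}"
  have fin: "finite A" using lf x y by (simp add: A_def locally_finite_def)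
  have ne: "y \<in> A" using y po by (auto simp: A_def refl_on_def)
  define R where "R = (\<lambda>a b. (a, b) \<in> r \<and> a \<noteq> b)"
  have "asymp_on A R" "transp_on A R"
    using po by (auto simp: R_def asymp_on_def transp_on_def antisym_def dest: transD)
  then obtain m where m: "m \<in> A" "\<forall>z\<in>A. \<not> R m z"
    using Finite_Set.bex_max_element[of A R] fin ne by (metis R_def emptyE)
  have "covers r x m"
    unfolding covers_def
  proof (intro conjI allI impI)
    show "(m, x) \<in> r" "m \<noteq> x" using m by (auto simp: A_def)
    fix z assume z: "(m, z) \<in> r \<and> (z, x) \<in> r"
    then have "z \<in> A \<or> z = x" using m po by (auto simp: A_def dest: transD)
    then show "z = m \<or> z = x" using m z by (auto simp: R_def)
  qed
  moreover have "m \<in> P" using m by (simp add: A_def)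
  ultimately show ?thesis using gr x by (auto simp: graded_by_def)
qed

lemma differential_poset_finite_rank:
  assumes D: "differential_poset d P r \<rho>"
  shows "finite {x \<in> P. \<rho> x = n}"
proof (induction n rule: less_induct)
  case (less n)
  show ?case
  proof (cases n)
    case 0
    obtain z where "\<forall>x. x \<in> P \<and> \<rho> x = 0 \<longrightarrow> x = z"
      using D unfolding differential_poset_def by blast
    then have "{x \<in> P. \<rho> x = n} \<subseteq> {z}" using 0 by auto
    then show ?thesis by (rule finite_subset) simp
  next
    case (Suc m)
    have gr: "graded_by P r \<rho>" using D by (simp add: differential_poset_def)
    have up: "finite {z \<in> P. covers r z y}" if y: "y \<in> P" "\<rho> y = m" for y
    proof -
      have "finite {z \<in> P. covers r y z}"
      proof (cases m)
        case 0
        then have "{z \<in> P. covers r y z} = {}" using gr y by (auto simp: graded_by_def)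
        then show ?thesis by (simp only: finite.emptyI)
      next
        case (Suc k)
        have "{z \<in> P. covers r y z} \<subseteq> {z \<in> P. \<rho> z = k}"
          using gr y Suc by (auto simp: graded_by_def)
        then show ?thesis using less[of k] Suc \<open>n = Suc m\<close> by (auto intro: finite_subset)
      qed
      then have "has_exactly {z \<in> P. covers r y z} (card {z \<in> P. covers r y z})"
        by (simp add: has_exactly_def)
      then have "has_exactly {z \<in> P. covers r z y} (card {z \<in> P. covers r y z} + d)"
        using D y by (simp add: differential_poset_def)
      then show ?thesis by (simp add: has_exactly_def)
    qed
    have "{x \<in> P. \<rho> x = n} \<subseteq> (\<Union>y\<in>{y \<in> P. \<rho> y = m}. {z \<in> P. covers r z y})"
      using differential_poset_exists_covered[OF D] Suc by fastforce
    moreover have "finite (\<Union>y\<in>{y \<in> P. \<rho> y = m}. {z \<in> P. covers r z y})"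
      using up less[of m] Suc by auto
    ultimately show ?thesis by (rule finite_subset)
  qed
qed

lemma differential_poset_countable:
  assumes D: "differential_poset d P r \<rho>"
  shows "countable P"
proof -
  have "countable (\<Union>n. {x \<in> P. \<rho> x = n})"
    using differential_poset_finite_rank[OF D] by (auto intro: countable_finite)
  moreover have "P = (\<Union>n. {x \<in> P. \<rho> x = n})" by auto
  ultimately show ?thesis by simp
qed

lemma has_exactly_image:
  assumes "inj_on f P" "A \<subseteq> P"
  shows "has_exactly (f ` A) k \<longleftrightarrow> has_exactly A k"
  using inj_on_subset[OF assms] by (simp add: has_exactly_def card_image finite_image_iff)

lemma differential_poset_image:
  assumes D: "differential_poset d P r \<rho>" and f: "inj_on f P"
  shows "differential_poset d (f ` P) (map_prod f f ` r) (\<lambda>y. \<rho> (inv_into P f y))"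
proof -
  define r' where "r' = map_prod f f ` r"
  let ?\<rho> = "\<lambda>y. \<rho> (inv_into P f y)"
  have po: "r \<subseteq> P \<times> P" "refl_on P r" "trans r" "antisym r"
    and lf: "locally_finite P r" and gr: "graded_by P r \<rho>" and d: "d > 0"
    and z: "\<exists>!x. x \<in> P \<and> \<rho> x = 0"
    using D by (auto simp: differential_poset_def partial_order_on_def preorder_on_def)
  have rr: "(f x, f y) \<in> r' \<longleftrightarrow> (x, y) \<in> r" if "x \<in> P" "y \<in> P" for x y
  proof
    assume "(f x, f y) \<in> r'"
    then obtain u v where uv: "(u, v) \<in> r" "f u = f x" "f v = f y"
      unfolding r'_def by force
    then have "u = x" "v = y" using that po(1) f by (auto dest: inj_onD)
    then show "(x, y) \<in> r" using uv by simp
  qed (auto simp: r'_def intro: rev_image_eqI)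
  have rs: "r' \<subseteq> f ` P \<times> f ` P" using po(1) by (auto simp: r'_def)
  have rh: "?\<rho> (f x) = \<rho> x" if "x \<in> P" for x using that f by simp
  have ff: "f x = f y \<longleftrightarrow> x = y" if "x \<in> P" "y \<in> P" for x y
    using that f by (auto dest: inj_onD)
  have cv: "covers r' (f x) (f y) \<longleftrightarrow> covers r x y" if xy: "x \<in> P" "y \<in> P" for x y
  proof -
    have "(\<forall>z. (f y, z) \<in> r' \<and> (z, f x) \<in> r' \<longrightarrow> z = f y \<or> z = f x) \<longleftrightarrow>
        (\<forall>z\<in>f ` P. (f y, z) \<in> r' \<and> (z, f x) \<in> r' \<longrightarrow> z = f y \<or> z = f x)"
      using rs by blast
    also have "\<dots> \<longleftrightarrow> (\<forall>z\<in>P. (y, z) \<in> r \<and> (z, x) \<in> r \<longrightarrow> z = y \<or> z = x)"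
      using xy by (simp add: rr ff)
    also have "\<dots> \<longleftrightarrow> (\<forall>z. (y, z) \<in> r \<and> (z, x) \<in> r \<longrightarrow> z = y \<or> z = x)"
      using po(1) by blast
    finally show ?thesis unfolding covers_def using xy by (simp add: rr ff)
  qed
  have im: "{z \<in> f ` P. Q z} = f ` {z \<in> P. Q (f z)}" for Q by auto
  have 1: "partial_order_on (f ` P) r'"
    unfolding partial_order_on_def preorder_on_def
  proof (intro conjI)
    show "r' \<subseteq> f ` P \<times> f ` P" by (rule rs)
    show "refl_on (f ` P) r'" using po(2) by (auto simp: refl_on_def rr)
    show "trans r'"
    proof (rule transI)
      fix a b c assume h: "(a, b) \<in> r'" "(b, c) \<in> r'"
      then obtain x y w where e: "x \<in> P" "y \<in> P" "w \<in> P" "a = f x" "b = f y" "c = f w"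
        using rs by blast
      then have "(x, y) \<in> r" "(y, w) \<in> r" using h rr by auto
      then show "(a, c) \<in> r'" using e rr po(3) by (meson transD)
    qed
    show "antisym r'"
    proof (rule antisymI)
      fix a b assume h: "(a, b) \<in> r'" "(b, a) \<in> r'"
      then obtain x y where e: "x \<in> P" "y \<in> P" "a = f x" "b = f y" using rs by blast
      then have "(x, y) \<in> r" "(y, x) \<in> r" using h rr by auto
      then show "a = b" using e po(4) by (auto dest: antisymD)
    qed
  qed
  have 2: "locally_finite (f ` P) r'"
    unfolding locally_finite_def im using lf
    by (auto simp: locally_finite_def rr cong: conj_cong)
  have 3: "graded_by (f ` P) r' ?\<rho>"
    using gr by (simp add: graded_by_def rr cv ff rh)
  obtain w where w: "w \<in> P" "\<rho> w = 0" "\<And>x. x \<in> P \<Longrightarrow> \<rho> x = 0 \<Longrightarrow> x = w" using z by blast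
  have 4: "\<exists>!x. x \<in> f ` P \<and> ?\<rho> x = 0"
  proof (rule ex1I[of _ "f w"])
    show "f w \<in> f ` P \<and> ?\<rho> (f w) = 0" using w(1,2) by (simp add: rh)
    fix x assume "x \<in> f ` P \<and> ?\<rho> x = 0"
    then obtain u where u: "u \<in> P" "x = f u" "?\<rho> (f u) = 0" by blast
    then have "\<rho> u = 0" using rh[of u] by simp
    then show "x = f w" using u(1,2) w(3)[of u] by simp
  qed
  have c1: "has_exactly {z \<in> f ` P. covers r' (f x) z \<and> covers r' (f y) z} k \<longleftrightarrow>
      has_exactly {z \<in> P. covers r x z \<and> covers r y z} k" if "x \<in> P" "y \<in> P" for x y k
  proof -
    have "{z \<in> P. covers r' (f x) (f z) \<and> covers r' (f y) (f z)} =
        {z \<in> P. covers r x z \<and> covers r y z}" using that by (auto simp: cv)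
    then show ?thesis unfolding im by (simp add: has_exactly_image[OF f])
  qed
  have c2: "has_exactly {z \<in> f ` P. covers r' z (f x) \<and> covers r' z (f y)} k \<longleftrightarrow>
      has_exactly {z \<in> P. covers r z x \<and> covers r z y} k" if "x \<in> P" "y \<in> P" for x y k
  proof -
    have "{z \<in> P. covers r' (f z) (f x) \<and> covers r' (f z) (f y)} =
        {z \<in> P. covers r z x \<and> covers r z y}" using that by (auto simp: cv)
    then show ?thesis unfolding im by (simp add: has_exactly_image[OF f])
  qed
  have 5: "\<forall>x\<in>f ` P. \<forall>y\<in>f ` P. x \<noteq> y \<longrightarrow> (\<forall>k.
        has_exactly {z \<in> f ` P. covers r' x z \<and> covers r' y z} k \<longleftrightarrow>
        has_exactly {z \<in> f ` P. covers r' z x \<and> covers r' z y} k)"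
  proof (intro ballI impI allI)
    fix a b k assume "a \<in> f ` P" "b \<in> f ` P" and ab: "a \<noteq> b"
    then obtain x y where xy: "x \<in> P" "y \<in> P" "a = f x" "b = f y" by blast
    then have "x \<noteq> y" using ab by blast
    then have "has_exactly {z \<in> P. covers r x z \<and> covers r y z} k \<longleftrightarrow>
        has_exactly {z \<in> P. covers r z x \<and> covers r z y} k"
      using D xy unfolding differential_poset_def by blast
    then show "has_exactly {z \<in> f ` P. covers r' a z \<and> covers r' b z} k \<longleftrightarrow>
        has_exactly {z \<in> f ` P. covers r' z a \<and> covers r' z b} k"
      using c1[OF xy(1,2)] c2[OF xy(1,2)] xy(3,4) by blast
  qed
  have 6: "\<forall>x\<in>f ` P. \<forall>m. has_exactly {z \<in> f ` P. covers r' x z} m \<longleftrightarrow>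
      has_exactly {z \<in> f ` P. covers r' z x} (m + d)"
  proof (intro ballI allI)
    fix a m assume "a \<in> f ` P"
    then obtain x where x: "x \<in> P" "a = f x" by blast
    have "has_exactly {z \<in> P. covers r x z} m \<longleftrightarrow> has_exactly {z \<in> P. covers r z x} (m + d)"
      using D x unfolding differential_poset_def by blast
    then show "has_exactly {z \<in> f ` P. covers r' a z} m \<longleftrightarrow>
        has_exactly {z \<in> f ` P. covers r' z a} (m + d)"
      using c1[OF x(1) x(1), of m] c2[OF x(1) x(1), of "m + d"] x(2) by simp
  qed
  show ?thesis
    unfolding differential_poset_def r'_def[symmetric] using d 1 2 3 4 5 6 by blast
qed

lemma rank_sizes_in_differential_rank_functions:
  fixes P :: "'a set"
  assumes D: "differential_poset d P r \<rho>"
  shows "rank_sizes P \<rho> \<in> differential_rank_functions"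
proof -
  obtain f :: "'a \<Rightarrow> nat" where f: "inj_on f P"
    using differential_poset_countable[OF D] by (auto simp: countable_def)
  have "rank_sizes P \<rho> = rank_sizes (f ` P) (\<lambda>y. \<rho> (inv_into P f y))"
  proof
    fix n
    have "{y \<in> f ` P. \<rho> (inv_into P f y) = n} = f ` {x \<in> P. \<rho> x = n}" using f by auto
    moreover have "inj_on f {x \<in> P. \<rho> x = n}" using f by (rule inj_on_subset) auto
    ultimately show "rank_sizes P \<rho> n = rank_sizes (f ` P) (\<lambda>y. \<rho> (inv_into P f y)) n"
      by (simp add: rank_sizes_def card_image)
  qed
  then show ?thesis
    using differential_poset_image[OF D f] by (auto simp: differential_rank_functions_def)
qed

end

theory Submission
  imports Defs
begin

text \<open>
  In a differential poset with four atoms, sending an element of rank two to the set of atoms below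
  it gives a system of blocks on four points in which every two points lie in exactly one common
  block and every point in exactly five blocks. Such a linear space has 14, 15 or 17 blocks
  (singletons included), which excludes 16.

  Conversely, a differential poset known up to rank \<open>n\<close> is continued to rank \<open>n + 1\<close> by choosing, for
  every \<open>x\<close> of rank \<open>n - 1\<close>, a linear space on the set of elements covering \<open>x\<close>, and adding
  singletons until the degrees are right. Taking all pairs in rank 2 and Wagner's
  one-block spaces afterwards yields \<open>1, 4, 14, 60, 254, \<dots>\<close>. Taking one block in rank 2,
  near-pencils on five points over all four atoms in rank 3 (\<open>72 - 4 \<cdot> 3 = 60\<close>), a near-pencil on
  five points over a single element in rank 4 (\<open>257 - 3 = 254\<close>) and one block everywhere else
  yields \<open>1, 4, 17, 60, 254, \<dots>\<close>.
\<close>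

section \<open>Adding one rank by means of linear spaces\<close>

text \<open>
  \<open>A\<close>, \<open>B\<close>, \<open>C\<close> are three consecutive ranks; \<open>E x y\<close> and \<open>F y c\<close> say that \<open>y\<close> covers \<open>x\<close> and \<open>c\<close>
  covers \<open>y\<close>.
\<close>

definition differential_step ::
    "nat \<Rightarrow> 'a set \<Rightarrow> 'b set \<Rightarrow> ('a \<Rightarrow> 'b \<Rightarrow> bool) \<Rightarrow> 'c set \<Rightarrow> ('b \<Rightarrow> 'c \<Rightarrow> bool) \<Rightarrow> bool" where
  "differential_step r A B E C F \<longleftrightarrow>
     finite C \<and> (\<forall>c\<in>C. \<exists>y\<in>B. F y c) \<and>
     (\<forall>y\<in>B. card {c \<in> C. F y c} = card {x \<in> A. E x y} + r) \<and>
     (\<forall>y\<in>B. \<forall>y'\<in>B. y \<noteq> y' \<longrightarrow>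
        card {c \<in> C. F y c \<and> F y' c} = card {x \<in> A. E x y \<and> E x y'})"

text \<open>Renames the elements of the new rank. This turns tagged blocks into natural numbers, so
  that steps can be iterated at a single type.\<close>

lemma differential_step_image:
  assumes S: "differential_step r A B E C F" and f: "inj_on f C"
  shows "differential_step r A B E (f ` C) (\<lambda>y c. F y (inv_into C f c))"
proof -
  have im: "card {c \<in> f ` C. Q (inv_into C f c)} = card {c \<in> C. Q c}" for Q
  proof -
    have "{c \<in> f ` C. Q (inv_into C f c)} = f ` {c \<in> C. Q c}" using f by auto
    moreover have "inj_on f {c \<in> C. Q c}" using f by (rule inj_on_subset) auto
    ultimately show ?thesis by (simp add: card_image)
  qed
  have "card {c \<in> f ` C. F y (inv_into C f c)} = card {c \<in> C. F y c}" for y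
    by (rule im)
  moreover have "card {c \<in> f ` C. F y (inv_into C f c) \<and> F y' (inv_into C f c)} =
      card {c \<in> C. F y c \<and> F y' c}" for y y'
    by (rule im[of "\<lambda>c. F y c \<and> F y' c"])
  ultimately show ?thesis
    using S f unfolding differential_step_def by simp
qed

text \<open>The new elements are the blocks of all \<open>L x\<close> together with extra
  singletons. Blocks of \<open>L x\<close> consist of elements above \<open>x\<close>, so
  \<open>y\<close> and \<open>y'\<close> share one block for each common lower cover and no other.
  Singletons leave these counts unchanged and fill up the degrees. The last conclusion locates the
  singletons that later serve as apexes.\<close>

lemma differential_step_blocks:
  fixes A :: "'a set" and B :: "'b set" and L :: "'a \<Rightarrow> 'b set set"
  assumes fin: "finite A" "finite B"
    and L: "\<And>x b. x \<in> A \<Longrightarrow> b \<in> L x \<Longrightarrow> b \<noteq> {} \<and> b \<subseteq> {y \<in> B. E x y}"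
    and pair: "\<And>x y y'. \<lbrakk>x \<in> A; y \<in> B; y' \<in> B; y \<noteq> y'; E x y; E x y'\<rbrakk> \<Longrightarrow>
      \<exists>!b. b \<in> L x \<and> y \<in> b \<and> y' \<in> b"
    and deg: "\<And>y. y \<in> B \<Longrightarrow> (\<Sum>x\<in>A. card {b \<in> L x. y \<in> b}) \<le> card {x \<in> A. E x y} + r"
  obtains C :: "nat set" and F where "differential_step r A B E C F"
    and "card C = (\<Sum>x\<in>A. card (L x)) +
      (\<Sum>y\<in>B. card {x \<in> A. E x y} + r - (\<Sum>x\<in>A. card {b \<in> L x. y \<in> b}))"
    and "\<And>y. y \<in> B \<Longrightarrow> (\<Sum>x\<in>A. card {b \<in> L x. y \<in> b}) < card {x \<in> A. E x y} + r \<Longrightarrow>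
      \<exists>c\<in>C. {z \<in> B. F z c} = {y}"
proof -
  \<comment> \<open>The number of singletons to add at \<open>y\<close>; the subtraction is exact by
    \<open>deg\<close>.\<close>
  define m where "m = (\<lambda>y. card {x \<in> A. E x y} + r - (\<Sum>x\<in>A. card {b \<in> L x. y \<in> b}))"
  \<comment> \<open>The tags keep equal sets apart: the same block over two different
    \<open>x\<close>, or two copies of a singleton, are different elements.\<close>
  define C where "C = Sigma A L <+> Sigma B (\<lambda>y. {..<m y})"
  define F :: "'b \<Rightarrow> ('a \<times> 'b set) + ('b \<times> nat) \<Rightarrow> bool"
    where "F = (\<lambda>y c. case c of Inl (x, b) \<Rightarrow> y \<in> b | Inr (z, j) \<Rightarrow> y = z)"
  have finL: "finite (L x)" if "x \<in> A" for x
    by (rule finite_subset[of _ "Pow B"]) (use L[OF that] fin in auto)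
  have finC: "finite C" unfolding C_def using fin finL by simp
  have "card {c \<in> C. F y c} = card {x \<in> A. E x y} + r" if y: "y \<in> B" for y
  proof -
    have "{c \<in> C. F y c} = Sigma A (\<lambda>x. {b \<in> L x. y \<in> b}) <+> Sigma {y} (\<lambda>y. {..<m y})"
    proof (rule set_eqI)
      show "c \<in> {c \<in> C. F y c} \<longleftrightarrow>
          c \<in> Sigma A (\<lambda>x. {b \<in> L x. y \<in> b}) <+> Sigma {y} (\<lambda>y. {..<m y})" for c
        using y by (cases c) (auto simp: C_def F_def)
    qed
    also have "card \<dots> = (\<Sum>x\<in>A. card {b \<in> L x. y \<in> b}) + m y"
      using fin finL by (subst card_Plus) auto
    finally show ?thesis using deg[OF y] by (simp add: m_def)
  qed
  moreover have "card {c \<in> C. F y c \<and> F y' c} = card {x \<in> A. E x y \<and> E x y'}"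
    if y: "y \<in> B" "y' \<in> B" "y \<noteq> y'" for y y'
  proof -
    let ?L = "\<lambda>x. {b \<in> L x. y \<in> b \<and> y' \<in> b}"
    have "{c \<in> C. F y c \<and> F y' c} = Inl ` Sigma {x \<in> A. E x y \<and> E x y'} ?L"
      using y L by (fastforce simp: C_def F_def split: sum.splits)
    then have "card {c \<in> C. F y c \<and> F y' c} = card (Sigma {x \<in> A. E x y \<and> E x y'} ?L)"
      by (simp add: card_image)
    also have "\<dots> = (\<Sum>x\<in>{x \<in> A. E x y \<and> E x y'}. card (?L x))"
      using fin finL by (subst card_SigmaI) auto
    also have "\<dots> = (\<Sum>x\<in>{x \<in> A. E x y \<and> E x y'}. 1)"
    proof (rule sum.cong)
      fix x assume "x \<in> {x \<in> A. E x y \<and> E x y'}"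
      then have "\<exists>!b. b \<in> L x \<and> y \<in> b \<and> y' \<in> b" using pair[of x y y'] y by blast
      then obtain b where "?L x = {b}" by blast
      then show "card (?L x) = 1" by simp
    qed simp
    finally show ?thesis by simp
  qed
  moreover have "\<forall>c\<in>C. \<exists>y\<in>B. F y c"
    using L by (fastforce simp: C_def F_def split: sum.splits)
  ultimately have S: "differential_step r A B E C F"
    using finC by (simp add: differential_step_def)
  obtain f :: "_ \<Rightarrow> nat" where f: "inj_on f C"
    using finite_imp_inj_to_nat_seg[OF finC] by blast
  show ?thesis
  proof (rule that[of "f ` C" "\<lambda>y c. F y (inv_into C f c)"])
    show "differential_step r A B E (f ` C) (\<lambda>y c. F y (inv_into C f c))"
      by (rule differential_step_image[OF S f])
    have "card (f ` C) = card C" using f by (rule card_image)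
    also have "\<dots> = (\<Sum>x\<in>A. card (L x)) + (\<Sum>y\<in>B. m y)"
      unfolding C_def using fin finL by (subst card_Plus) auto
    finally show "card (f ` C) = (\<Sum>x\<in>A. card (L x)) +
      (\<Sum>y\<in>B. card {x \<in> A. E x y} + r - (\<Sum>x\<in>A. card {b \<in> L x. y \<in> b}))"
      by (simp add: m_def)
    fix y assume y: "y \<in> B" "(\<Sum>x\<in>A. card {b \<in> L x. y \<in> b}) < card {x \<in> A. E x y} + r"
    then have "Inr (y, 0) \<in> C" by (auto simp: C_def m_def)
    moreover have "{z \<in> B. F z (Inr (y, 0))} = {y}" using y by (auto simp: F_def)
    ultimately show "\<exists>c\<in>f ` C. {z \<in> B. F z (inv_into C f c)} = {y}"
      using f by (intro bexI[of _ "f (Inr (y, 0))"]) auto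
  qed
qed

text \<open>
  The linear space over \<open>x\<close> is the near-pencil on \<open>U x\<close> with apex \<open>a x\<close> if \<open>x \<in> M\<close>, and the single
  block \<open>U x\<close> otherwise. \<open>X x y\<close> is the number of additional blocks through \<open>y\<close> due to the
  near-pencil over \<open>x\<close>.
\<close>

lemma differential_step_near_pencil:
  fixes A :: "'a set" and B :: "'b set" and E r M a
  defines "U \<equiv> \<lambda>x. {y \<in> B. E x y}"
  defines "X \<equiv> \<lambda>x y. if x \<in> M \<and> E x y then if y = a x then card (U x) - 2 else 1 else (0::nat)"
  assumes fin: "finite A" "finite B"
    and ne: "\<And>x. x \<in> A \<Longrightarrow> U x \<noteq> {}"
    and M: "M \<subseteq> A" "\<And>x. x \<in> M \<Longrightarrow> a x \<in> U x" "\<And>x. x \<in> M \<Longrightarrow> card (U x) \<ge> 3"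
    and deg: "\<And>y. y \<in> B \<Longrightarrow> (\<Sum>x\<in>A. X x y) \<le> r"
  obtains C :: "nat set" and F where "differential_step r A B E C F"
    and "card C + (\<Sum>x\<in>M. card (U x) - 2) = card A + r * card B"
    and "\<And>y. y \<in> B \<Longrightarrow> (\<Sum>x\<in>A. X x y) < r \<Longrightarrow> \<exists>c\<in>C. {z \<in> B. F z c} = {y}"
proof -
  \<comment> \<open>The near-pencil: the points other than the apex form one long block, and a pair
    joins each of them to the apex.\<close>
  define N where "N = (\<lambda>x. insert (U x - {a x}) ((\<lambda>y. {a x, y}) ` (U x - {a x})))"
  define L where "L = (\<lambda>x. if x \<in> M then N x else {U x})"
  have finU: "finite (U x)" for x using fin by (simp add: U_def)
  have M2: "\<exists>u v. u \<in> U x - {a x} \<and> v \<in> U x - {a x} \<and> u \<noteq> v" if "x \<in> M" for x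
  proof -
    have "card (U x - {a x}) \<ge> 2" using M(2,3)[OF that] finU[of x] by simp
    then have "\<not> card (U x - {a x}) \<le> Suc 0" by simp
    then show ?thesis using finU by (subst (asm) card_le_Suc0_iff_eq) auto
  qed
  have inj: "inj_on (\<lambda>y. {a x, y}) (U x - {a x})" for x
    by (auto simp: inj_on_def doubleton_eq_iff)
  have notin: "U x - {a x} \<notin> (\<lambda>y. {a x, y}) ` (U x - {a x})" for x by auto
  have cN: "card (N x) = card (U x)" if "x \<in> M" for x
  proof -
    have "card (N x) = Suc (card (U x - {a x}))"
      unfolding N_def using notin finU by (subst card_insert_disjoint) (auto simp: card_image[OF inj])
    then show ?thesis using M(2)[OF that] finU by (metis card_Suc_Diff1)
  qed
  \<comment> \<open>In a single block every point has degree one. In the near-pencil the apex lies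
    in \<open>card (U x) - 1\<close> pairs, any other point in the long block and one pair;
    \<open>X\<close> is the surplus.\<close>
  have deg1: "card {b \<in> L x. y \<in> b} = (if E x y then 1 else 0) + X x y"
    if x: "x \<in> A" and y: "y \<in> B" for x y
  proof (cases "x \<in> M \<and> E x y")
    case False
    then show ?thesis
    proof (cases "x \<in> M")
      case True
      then have "{b \<in> L x. y \<in> b} = {}" using False M(2)[of x] by (auto simp: L_def N_def U_def)
      then show ?thesis using False True by (simp only: X_def) simp
    next
      case F: False
      then have "{b \<in> L x. y \<in> b} = (if E x y then {U x} else {})" using y by (auto simp: L_def U_def)
      then show ?thesis using F by (simp add: X_def)
    qed
  next
    case T: True
    then have yU: "y \<in> U x" using y by (simp add: U_def)
    show ?thesis
    proof (cases "y = a x")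
      case True
      then have "{b \<in> L x. y \<in> b} = (\<lambda>y. {a x, y}) ` (U x - {a x})" using T by (auto simp: L_def N_def)
      then have "card {b \<in> L x. y \<in> b} = card (U x) - 1"
        using inj[of x] M(2)[of x] T finU by (simp add: card_image)
      then show ?thesis using T True M(3)[of x] by (simp add: X_def)
    next
      case False
      then have "{b \<in> L x. y \<in> b} = {U x - {a x}, {a x, y}}" using T yU by (auto simp: L_def N_def)
      moreover have "U x - {a x} \<noteq> {a x, y}" by auto
      ultimately show ?thesis using T False by (simp add: X_def)
    qed
  qed
  have deg2: "(\<Sum>x\<in>A. card {b \<in> L x. y \<in> b}) = card {x \<in> A. E x y} + (\<Sum>x\<in>A. X x y)"
    if y: "y \<in> B" for y
  proof -
    have "(\<Sum>x\<in>A. card {b \<in> L x. y \<in> b}) = (\<Sum>x\<in>A. (if E x y then 1 else 0) + X x y)"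
      using deg1[OF _ y] by simp
    also have "\<dots> = (\<Sum>x\<in>A. if E x y then 1 else 0) + (\<Sum>x\<in>A. X x y)" by (rule sum.distrib)
    also have "(\<Sum>x\<in>A. if E x y then 1 else 0) = card {x \<in> A. E x y}"
      using fin by (simp add: sum.If_cases Int_def)
    finally show ?thesis .
  qed
  have 1: "b \<noteq> {} \<and> b \<subseteq> {y \<in> B. E x y}" if "x \<in> A" "b \<in> L x" for x b
  proof (cases "x \<in> M")
    case True
    then show ?thesis using that M2[OF True] M(2)[OF True] by (auto simp: L_def N_def U_def)
  next
    case False
    then show ?thesis using that ne[of x] by (auto simp: L_def U_def)
  qed
  have 2: "\<exists>!b. b \<in> L x \<and> y \<in> b \<and> y' \<in> b"
    if h: "x \<in> A" "y \<in> B" "y' \<in> B" "y \<noteq> y'" "E x y" "E x y'" for x y y'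
  proof (cases "x \<in> M")
    case True
    have u: "y \<in> U x" "y' \<in> U x" using h by (auto simp: U_def)
    \<comment> \<open>Two points are joined by their pair if one of them is the apex, and by the
      long block otherwise.\<close>
    consider "y = a x" | "y' = a x" | "y \<noteq> a x" "y' \<noteq> a x" by blast
    then show ?thesis
    proof cases
      case 1
      then show ?thesis using u h(4) True
        by (intro ex1I[of _ "{y, y'}"]) (auto simp: L_def N_def)
    next
      case 2
      then show ?thesis using u h(4) True
        by (intro ex1I[of _ "{y', y}"]) (auto simp: L_def N_def)
    next
      case 3
      then show ?thesis using u h(4) True
        by (intro ex1I[of _ "U x - {a x}"]) (auto simp: L_def N_def)
    qed
  next
    case False
    then show ?thesis using h by (auto simp: L_def U_def)
  qed
  have 3: "(\<Sum>x\<in>A. card {b \<in> L x. y \<in> b}) \<le> card {x \<in> A. E x y} + r" if "y \<in> B" for y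
    using deg2[OF that] deg[OF that] by simp
  obtain C :: "nat set" and F where S: "differential_step r A B E C F"
    and c: "card C = (\<Sum>x\<in>A. card (L x)) +
      (\<Sum>y\<in>B. card {x \<in> A. E x y} + r - (\<Sum>x\<in>A. card {b \<in> L x. y \<in> b}))"
    and s: "\<And>y. y \<in> B \<Longrightarrow> (\<Sum>x\<in>A. card {b \<in> L x. y \<in> b}) < card {x \<in> A. E x y} + r \<Longrightarrow>
      \<exists>c\<in>C. {z \<in> B. F z c} = {y}"
    using differential_step_blocks[of A B L E r, OF fin 1 2 3] by blast
  show ?thesis
  proof (rule that[OF S])
    show "\<exists>c\<in>C. {z \<in> B. F z c} = {y}" if "y \<in> B" "(\<Sum>x\<in>A. X x y) < r" for y
      using s[OF that(1)] that deg2[OF that(1)] by simp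
    \<comment> \<open>Let u be \<open>card (U x)\<close>. Replacing a single block by a near-pencil
      adds u - 1 blocks and saves one singleton for each of the (u - 1) + (u - 2) surplus
      incidences, a net loss of u - 2.\<close>
    have "(\<Sum>y\<in>B. card {x \<in> A. E x y} + r - (\<Sum>x\<in>A. card {b \<in> L x. y \<in> b})) =
        (\<Sum>y\<in>B. r - (\<Sum>x\<in>A. X x y))"
      by (rule sum.cong) (simp_all add: deg2)
    moreover have "(\<Sum>y\<in>B. r - (\<Sum>x\<in>A. X x y)) + (\<Sum>y\<in>B. \<Sum>x\<in>A. X x y) = r * card B"
      using deg by (simp add: sum.distrib[symmetric])
    moreover have "(\<Sum>y\<in>B. \<Sum>x\<in>A. X x y) = (\<Sum>x\<in>M. (card (U x) - 1) + (card (U x) - 2))"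
    proof -
      have "(\<Sum>y\<in>B. \<Sum>x\<in>A. X x y) = (\<Sum>x\<in>A. \<Sum>y\<in>B. X x y)" by (rule sum.swap)
      also have "\<dots> = (\<Sum>x\<in>M. \<Sum>y\<in>B. X x y)"
        using fin M(1) by (intro sum.mono_neutral_right) (auto simp: X_def)
      also have "\<dots> = (\<Sum>x\<in>M. (card (U x) - 1) + (card (U x) - 2))"
      proof (rule sum.cong)
        fix x assume x: "x \<in> M"
        have "(\<Sum>y\<in>B. X x y) = (\<Sum>y\<in>U x. X x y)"
          using fin by (intro sum.mono_neutral_right) (auto simp: X_def U_def)
        also have "\<dots> = X x (a x) + (\<Sum>y\<in>U x - {a x}. X x y)"
          using M(2)[OF x] finU by (simp add: sum.remove)
        also have "(\<Sum>y\<in>U x - {a x}. X x y) = (\<Sum>y\<in>U x - {a x}. 1)"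
          using x by (intro sum.cong) (auto simp: X_def U_def)
        also have "\<dots> = card (U x) - 1" using M(2)[OF x] finU by simp
        also have "X x (a x) = card (U x) - 2" using M(2)[OF x] x by (simp add: X_def U_def)
        finally show "(\<Sum>y\<in>B. X x y) = (card (U x) - 1) + (card (U x) - 2)" by simp
      qed simp
      finally show ?thesis .
    qed
    moreover have "(\<Sum>x\<in>A. card (L x)) = card A + (\<Sum>x\<in>M. card (U x) - 1)"
    proof -
      have "(\<Sum>x\<in>A. card (L x)) = (\<Sum>x\<in>A. 1 + (if x \<in> M then card (U x) - 1 else 0))"
      proof (rule sum.cong)
        fix x assume "x \<in> A"
        show "card (L x) = 1 + (if x \<in> M then card (U x) - 1 else 0)"
          using cN[of x] M(3)[of x] by (auto simp: L_def)
      qed simp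
      also have "\<dots> = card A + (\<Sum>x\<in>A. if x \<in> M then card (U x) - 1 else 0)"
        by (subst sum.distrib) simp
      also have "(\<Sum>x\<in>A. if x \<in> M then card (U x) - 1 else 0) = (\<Sum>x\<in>M. card (U x) - 1)"
        using fin M(1) by (simp add: sum.If_cases Int_absorb1)
      finally show ?thesis .
    qed
    ultimately show "card C + (\<Sum>x\<in>M. card (U x) - 2) = card A + r * card B"
      using c by (simp add: sum.distrib)
  qed
qed

text \<open>The case without near-pencils: over each \<open>x\<close> lies a single block, every
  degree is then short by \<open>r\<close>, and \<open>r\<close> singletons at each element of
  \<open>B\<close> make up for it.\<close>

lemma differential_step_Wagner:
  fixes A :: "'a set" and B :: "'b set"
  assumes "finite A" "finite B" "\<And>x. x \<in> A \<Longrightarrow> {y \<in> B. E x y} \<noteq> {}"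
  obtains C :: "nat set" and F where "differential_step r A B E C F"
    and "card C = card A + r * card B"
    and "\<And>y. y \<in> B \<Longrightarrow> r > 0 \<Longrightarrow> \<exists>c\<in>C. {z \<in> B. F z c} = {y}"
\<comment> \<open>\<open>undefined\<close> stands for the apexes of an empty family of
  near-pencils.\<close>
proof (rule differential_step_near_pencil[of A B E "{}" undefined r, OF assms])
  fix C :: "nat set" and F
  assume h: "differential_step r A B E C F"
    "card C + (\<Sum>x\<in>{}. card {y \<in> B. E x y} - 2) = card A + r * card B"
    "\<And>y. \<lbrakk>y \<in> B; (\<Sum>x\<in>A. if x \<in> {} \<and> E x y
        then if y = undefined x then card {y \<in> B. E x y} - 2 else 1 else 0) < r\<rbrakk>
      \<Longrightarrow> \<exists>c\<in>C. {z \<in> B. F z c} = {y}"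
  show thesis
    by (rule that[OF h(1)]) (use h(2,3) in simp_all)
qed auto

section \<open>From sequences of ranks to differential posets\<close>

text \<open>\<open>A\<close> and \<open>B\<close> are the first two ranks, with covering relation \<open>E\<close> between them.\<close>

definition extends_with_ranks ::
    "nat \<Rightarrow> nat set \<Rightarrow> nat set \<Rightarrow> (nat \<Rightarrow> nat \<Rightarrow> bool) \<Rightarrow> (nat \<Rightarrow> int) \<Rightarrow> bool" where
  "extends_with_ranks r A B E h \<longleftrightarrow>
     (\<exists>V G. V 0 = A \<and> V (Suc 0) = B \<and> G 0 = E \<and> (\<forall>n. int (card (V n)) = h n) \<and>
        (\<forall>n. differential_step r (V n) (V (Suc n)) (G n) (V (Suc (Suc n))) (G (Suc n))))"

text \<open>Shifts the sequences by one index, so that the special low ranks can be put below an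
  infinite continuation one at a time.\<close>

lemma extends_with_ranks_step:
  assumes "differential_step r A B E C F" "extends_with_ranks r B C F (\<lambda>n. h (Suc n))"
    "int (card A) = h 0"
  shows "extends_with_ranks r A B E h"
proof -
  obtain V G where VG: "V 0 = B" "V (Suc 0) = C" "G 0 = F" "\<And>n. int (card (V n)) = h (Suc n)"
    "\<And>n. differential_step r (V n) (V (Suc n)) (G n) (V (Suc (Suc n))) (G (Suc n))"
    using assms(2) unfolding extends_with_ranks_def by blast
  show ?thesis
    unfolding extends_with_ranks_def
  proof (intro exI conjI allI)
    show "int (card (case_nat A V n)) = h n" for n
      using assms(3) VG(4) by (cases n) auto
    show "differential_step r (case_nat A V n) (case_nat A V (Suc n)) (case_nat E G n)
        (case_nat A V (Suc (Suc n))) (case_nat E G (Suc n))" for n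
      using assms(1) VG by (cases n) auto
  qed (use VG in auto)
qed

text \<open>The count in Wagner's step is the recurrence for \<open>h\<close>. The step can be
  repeated because \<open>r > 0\<close> gives every element of \<open>B\<close> an upper cover, so
  nonemptiness is inherited.\<close>

lemma extends_with_ranks_Wagner:
  assumes fin: "finite A" "finite B" and ne: "\<And>x. x \<in> A \<Longrightarrow> {y \<in> B. E x y} \<noteq> {}" and r: "r > 0"
    and h: "int (card A) = h 0" "int (card B) = h 1"
      "\<And>n. h (Suc (Suc n)) = int r * h (Suc n) + h n"
  shows "extends_with_ranks r A B E h"
proof -
  define P where "P = (\<lambda>n (A :: nat set, B :: nat set, E :: nat \<Rightarrow> nat \<Rightarrow> bool). finite A \<and> finite B \<and> (\<forall>x\<in>A. {y \<in> B. E x y} \<noteq> {}) \<and>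
    int (card A) = h n \<and> int (card B) = h (Suc n))"
  \<comment> \<open>Besides the step itself, \<open>Q\<close> makes the second rank of a state the
    first rank of its successor.\<close>
  define Q where "Q = (\<lambda>n :: nat. \<lambda>(A, B, E) (B', C, F). B' = B \<and>
    differential_step r A B (E :: nat \<Rightarrow> nat \<Rightarrow> bool) (C :: nat set) F)"
  have step: "\<exists>t. P (Suc n) t \<and> Q n s t" if "P n s" for n s
  proof -
    obtain A B E where s: "s = (A, B, E)" by (cases s)
    have p: "finite A" "finite B" "\<And>x. x \<in> A \<Longrightarrow> {y \<in> B. E x y} \<noteq> {}"
      "int (card A) = h n" "int (card B) = h (Suc n)" using that by (auto simp: P_def s)
    obtain C :: "nat set" and F where C: "differential_step r A B E C F"
      "card C = card A + r * card B"
      by (rule differential_step_Wagner[of A B E r, OF p(1-3)])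
    have "{c \<in> C. F y c} \<noteq> {}" if "y \<in> B" for y
    proof -
      have "card {c \<in> C. F y c} > 0" using C(1) that r by (simp add: differential_step_def)
      then show ?thesis by (metis card.empty less_irrefl)
    qed
    moreover have "finite C" using C(1) by (simp add: differential_step_def)
    ultimately have "P (Suc n) (B, C, F)" using p C(2) h(3)[of n] by (auto simp: P_def)
    then show ?thesis using C(1) by (intro exI[of _ "(B, C, F)"]) (auto simp: Q_def s)
  qed
  obtain f where f: "f 0 = (A, B, E)" "\<And>n. P n (f n)" "\<And>n. Q n (f n) (f (Suc n))"
  proof -
    \<comment> \<open>The clause for \<open>n = 0\<close> pins down the initial state, of which the
      choice principle gives only existence.\<close>
    have "\<exists>f. \<forall>n. (P n (f n) \<and> (n = 0 \<longrightarrow> f n = (A, B, E))) \<and> Q n (f n) (f (Suc n))"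
      by (rule dependent_nat_choice[where P = "\<lambda>n s. P n s \<and> (n = 0 \<longrightarrow> s = (A, B, E))"])
        (use step fin ne h in \<open>auto simp: P_def\<close>)
    then show ?thesis using that by blast
  qed
  show ?thesis
    unfolding extends_with_ranks_def
  proof (intro exI conjI allI)
    let ?V = "\<lambda>n. fst (f n)" and ?G = "\<lambda>n. snd (snd (f n))"
    show "?V 0 = A" "?V (Suc 0) = B" "?G 0 = E"
      using f(1) f(3)[of 0] by (auto simp: Q_def split: prod.splits)
    show "int (card (?V n)) = h n" for n
      using f(2)[of n] by (auto simp: P_def split: prod.splits)
    show "differential_step r (?V n) (?V (Suc n)) (?G n) (?V (Suc (Suc n))) (?G (Suc n))" for n
      using f(3)[of n] f(3)[of "Suc n"] by (auto simp: Q_def split: prod.splits)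
  qed
qed

text \<open>The ranks, made disjoint by tags, are ordered by the closure of the given relations.
  Each relation raises the rank by exactly one, so the covers are the given pairs. The steps yield
  both axioms from rank one on; in rank zero, \<open>v\<close> covers nothing and is covered by the
  \<open>r\<close> elements of \<open>B\<close>.\<close>

lemma extends_with_ranks_differential:
  assumes X: "extends_with_ranks r {v} B (\<lambda>_ _. True) h" and B: "finite B" "card B = r" and r: "r > 0"
  shows "h \<in> differential_rank_functions"
proof -
  obtain V G where V: "V 0 = {v}" "V (Suc 0) = B" "G 0 = (\<lambda>_ _. True)"
    "\<And>n. int (card (V n)) = h n"
    and S: "\<And>n. differential_step r (V n) (V (Suc n)) (G n) (V (Suc (Suc n))) (G (Suc n))"
    using X unfolding extends_with_ranks_def by blast
  \<comment> \<open>For \<open>n\<close> at least two, \<open>V n\<close> is the new rank of step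
    \<open>n - 2\<close>.\<close>
  have fin: "finite (V n)" for n
    using V(1,2) B(1) S[of "n - 2"]
    by (cases n rule: nat.exhaust; cases "n - 1") (auto simp: differential_step_def)
  define P where "P = {(n, i). i \<in> V n}"
  define R where "R = {((n, i), (Suc n, j)) | n i j. i \<in> V n \<and> j \<in> V (Suc n) \<and> G n i j}"
  \<comment> \<open>\<open>R\<^sup>*\<close> is reflexive on the whole type, hence the restriction
    to \<open>P\<close>.\<close>
  define Q where "Q = {(x, y) \<in> R\<^sup>*. x \<in> P \<and> y \<in> P}"
  have RP: "x \<in> P \<and> y \<in> P \<and> fst y = Suc (fst x)" if "(x, y) \<in> R" for x y
    using that by (auto simp: R_def P_def)
  have QP: "x \<in> P" "y \<in> P" if "(x, y) \<in> Q" for x y using that by (auto simp: Q_def)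
  have le: "fst x \<le> fst y \<and> (fst x = fst y \<longrightarrow> x = y)" if "(x, y) \<in> R\<^sup>*" for x y
    using that by (induction rule: rtrancl_induct) (use RP in fastforce)+
  \<comment> \<open>A chain from \<open>y\<close> up to \<open>x\<close> begins with a step of
    \<open>R\<close>, and a cover leaves no room for a second one. Conversely, nothing fits strictly
    between consecutive ranks.\<close>
  have cov: "covers Q x y \<longleftrightarrow> (y, x) \<in> R" for x y
  proof
    assume c: "covers Q x y"
    then have "(y, x) \<in> R\<^sup>*" "y \<noteq> x" "x \<in> P" "y \<in> P" by (auto simp: covers_def Q_def)
    then obtain z where z: "(y, z) \<in> R" "(z, x) \<in> R\<^sup>*" by (metis converse_rtranclE)
    then have "(y, z) \<in> Q" "(z, x) \<in> Q" "z \<noteq> y"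
      using RP[OF z(1)] \<open>x \<in> P\<close> by (auto simp: Q_def)
    then have "z = x" using c unfolding covers_def by blast
    then show "(y, x) \<in> R" using z by simp
  next
    assume c: "(y, x) \<in> R"
    show "covers Q x y"
      unfolding covers_def
    proof (intro conjI allI impI)
      show "(y, x) \<in> Q" "y \<noteq> x" using c RP[OF c] by (auto simp: Q_def)
      fix z assume "(y, z) \<in> Q \<and> (z, x) \<in> Q"
      then have "(y, z) \<in> R\<^sup>*" "(z, x) \<in> R\<^sup>*" by (auto simp: Q_def)
      then show "z = y \<or> z = x" using le[of y z] le[of z x] RP[OF c] by (metis le_SucE le_antisym)
    qed
  qed
  have po: "partial_order_on P Q"
    unfolding partial_order_on_def preorder_on_def
  proof (intro conjI)
    show "Q \<subseteq> P \<times> P" by (auto simp: Q_def)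
    show "refl_on P Q" by (auto simp: refl_on_def Q_def)
    show "trans Q" by (auto simp: trans_def Q_def)
    show "antisym Q"
    proof (rule antisymI)
      fix x y assume "(x, y) \<in> Q" "(y, x) \<in> Q"
      then show "x = y" using le[of x y] le[of y x] by (auto simp: Q_def)
    qed
  qed
  have lf: "locally_finite P Q"
    unfolding locally_finite_def
  proof (intro ballI)
    fix x y
    have "{z \<in> P. (x, z) \<in> Q \<and> (z, y) \<in> Q} \<subseteq> Sigma {..fst y} V"
      using le by (fastforce simp: P_def Q_def)
    then show "finite {z \<in> P. (x, z) \<in> Q \<and> (z, y) \<in> Q}"
      by (rule finite_subset) (use fin in auto)
  qed
  \<comment> \<open>Rank one lies above \<open>v\<close> because \<open>G 0\<close> is constantly
    true; for higher ranks this is part of the step.\<close>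
  have below: "\<exists>i\<in>V n. G n i j" if "j \<in> V (Suc n)" for n j
    using that V S[of "n - 1"] by (cases n) (auto simp: differential_step_def)
  have gr: "graded_by P Q fst"
    unfolding graded_by_def
  proof (intro conjI ballI impI)
    fix x assume x: "x \<in> P" "\<forall>y\<in>P. (y, x) \<in> Q \<longrightarrow> y = x"
    show "fst x = 0"
    proof (rule ccontr)
      assume "fst x \<noteq> 0"
      then obtain n j where n: "x = (Suc n, j)" "j \<in> V (Suc n)"
        using x(1) by (cases x; cases "fst x") (auto simp: P_def)
      then obtain i where "i \<in> V n" "G n i j" using below by blast
      then have "((n, i), x) \<in> R" using n by (auto simp: R_def)
      then have "((n, i), x) \<in> Q" "(n, i) \<in> P" using RP by (auto simp: Q_def)
      then show False using x(2) n by auto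
    qed
  qed (use cov RP in blast)
  \<comment> \<open>The predicate \<open>T\<close> lets one equation serve for the covers of one
    element and for the common covers of two.\<close>
  have down: "{z \<in> P. covers Q (Suc n, j) z \<and> T z} = Pair n ` {i \<in> V n. G n i j \<and> T (n, i)}"
    if "j \<in> V (Suc n)" for n j T
    using that by (auto simp: cov R_def P_def)
  have up: "{z \<in> P. covers Q z (n, i) \<and> T z} =
      Pair (Suc n) ` {j \<in> V (Suc n). G n i j \<and> T (Suc n, j)}"
    if "i \<in> V n" for n i T
    using that by (auto simp: cov R_def P_def)
  have card_Pair: "has_exactly (Pair n ` {i \<in> V n. T i}) k \<longleftrightarrow> card {i \<in> V n. T i} = k" for n k T
    using fin[of n] by (auto simp: has_exactly_def card_image inj_on_def)
  have c1: "has_exactly {z \<in> P. covers Q x z \<and> covers Q y z} k \<longleftrightarrow>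
      has_exactly {z \<in> P. covers Q z x \<and> covers Q z y} k"
    if xy: "x \<in> P" "y \<in> P" "x \<noteq> y" for x y k
  proof (cases "fst x = fst y")
    case False
    have "\<not> ((z, x) \<in> R \<and> (z, y) \<in> R)" "\<not> ((x, z) \<in> R \<and> (y, z) \<in> R)" for z
      using RP[of z x] RP[of z y] RP[of x z] RP[of y z] False by auto
    then have "{z \<in> P. covers Q x z \<and> covers Q y z} = {}"
        "{z \<in> P. covers Q z x \<and> covers Q z y} = {}"
      unfolding cov by blast+
    then show ?thesis by (simp only:)
  next
    case True
    then obtain m i j where ij: "x = (m, i)" "y = (m, j)" by (metis prod.collapse)
    \<comment> \<open>Rank zero has a single element, so two distinct elements of equal rank fall
      under a step.\<close>
    then obtain n where n: "m = Suc n" using xy V(1) by (cases m) (auto simp: P_def)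
    have V': "i \<in> V (Suc n)" "j \<in> V (Suc n)" "i \<noteq> j" using xy ij n by (auto simp: P_def)
    have "covers Q (Suc n, k) (n, l) \<longleftrightarrow> G n l k" if "k \<in> V (Suc n)" "l \<in> V n" for k l n
      using that by (auto simp: cov R_def)
    then have "{l \<in> V n. G n l i \<and> covers Q (Suc n, j) (n, l)} = {l \<in> V n. G n l i \<and> G n l j}"
      "{l \<in> V (Suc (Suc n)). G (Suc n) i l \<and> covers Q (Suc (Suc n), l) (Suc n, j)} =
       {l \<in> V (Suc (Suc n)). G (Suc n) i l \<and> G (Suc n) j l}"
      using V' by auto
    then show ?thesis
      using V' S[of n] unfolding ij n by (simp add: down up card_Pair differential_step_def)
  qed
  have c2: "has_exactly {z \<in> P. covers Q x z} m \<longleftrightarrow> has_exactly {z \<in> P. covers Q z x} (m + r)"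
    if x: "x \<in> P" for x m
  proof (cases "fst x")
    case 0
    then have x0: "x = (0, v)" using x V(1) by (cases x) (auto simp: P_def)
    have "{z \<in> P. covers Q x z} = {}" using 0 RP by (fastforce simp: cov)
    then have "has_exactly {z \<in> P. covers Q x z} m \<longleftrightarrow> m = 0"
      by (simp only: has_exactly_def) auto
    moreover have "has_exactly {z \<in> P. covers Q z x} k \<longleftrightarrow> r = k" for k
      unfolding x0 using up[of v 0 "\<lambda>_. True"] card_Pair[of "Suc 0" "\<lambda>_. True" k] V B by simp
    ultimately show ?thesis by simp
  next
    case (Suc n)
    then obtain j where j: "x = (Suc n, j)" "j \<in> V (Suc n)" using x by (cases x) (auto simp: P_def)
    show ?thesis
      unfolding j(1)
      using down[of j n "\<lambda>_. True"] up[of j "Suc n" "\<lambda>_. True"] j(2) S[of n]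
      by (simp add: card_Pair differential_step_def)
  qed
  have "differential_poset r P Q fst"
    unfolding differential_poset_def using r po lf gr c1 c2 V(1) by (auto simp: P_def)
  moreover have "rank_sizes P fst = h"
  proof
    fix n
    have "{x \<in> P. fst x = n} = Pair n ` V n" by (auto simp: P_def)
    then show "rank_sizes P fst n = h n"
      using V(4)[of n] by (simp add: rank_sizes_def card_image inj_on_def)
  qed
  ultimately show ?thesis using rank_sizes_in_differential_rank_functions by metis
qed

section \<open>The sequences with 14 and 17 elements in rank two\<close>

text \<open>Each atom lies in three of the six pairs and needs degree five, which leaves two
  singletons per atom: 6 + 8 = 14. Wagner's step then gives 4 * 14 + 4 = 60 and 4 * 60 + 14 =
  254.\<close>

lemma seq60_14_mem: "seq60 14 \<in> differential_rank_functions"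
proof -
  define A :: "nat set" where "A = {0}"
  define B :: "nat set" where "B = {..<4}"
  define E :: "nat \<Rightarrow> nat \<Rightarrow> bool" where "E = (\<lambda>_ _. True)"
  define L where "L = (\<lambda>x :: nat. {b. b \<subseteq> B \<and> card b = 2})"
  have deg: "card {b \<in> L x. y \<in> b} = 3" if y: "y \<in> B" for x y
  proof -
    have "{b \<in> L x. y \<in> b} = (\<lambda>z. {y, z}) ` (B - {y})"
      using y by (auto simp: L_def card_2_iff)
    moreover have "inj_on (\<lambda>z. {y, z}) (B - {y})" by (auto simp: inj_on_def doubleton_eq_iff)
    ultimately show ?thesis using y by (simp add: card_image B_def)
  qed
  have cL: "card (L x) = 6" for x
    unfolding L_def using n_subsets[of B 2] by (simp add: B_def numeral_eq_Suc)
  have 1: "\<exists>!b. b \<in> L x \<and> y \<in> b \<and> y' \<in> b" if "y \<in> B" "y' \<in> B" "y \<noteq> y'" for x y y'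
    by (rule ex1I[of _ "{y, y'}"]) (use that in \<open>auto simp: L_def card_2_iff\<close>)
  obtain C :: "nat set" and F where C: "differential_step 4 A B E C F"
    and c: "card C = (\<Sum>x\<in>A. card (L x)) +
      (\<Sum>y\<in>B. card {x \<in> A. E x y} + 4 - (\<Sum>x\<in>A. card {b \<in> L x. y \<in> b}))"
  proof (rule differential_step_blocks[of A B L E 4])
    show "finite A" "finite B" by (auto simp: A_def B_def)
    show "b \<noteq> {} \<and> b \<subseteq> {y \<in> B. E x y}" if "b \<in> L x" for x b
      using that by (auto simp: L_def E_def)
  qed (use 1 deg in \<open>auto simp: A_def E_def\<close>)
  have "card C = 14" unfolding c using deg by (simp add: A_def E_def cL) (simp add: B_def)
  moreover have "{c \<in> C. F y c} \<noteq> {}" if "y \<in> B" for y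
  proof -
    have "card {c \<in> C. F y c} > 0" using C that by (simp add: differential_step_def)
    then show ?thesis by (metis card.empty less_irrefl)
  qed
  \<comment> \<open>At index two the recurrence would give 17 instead of 14, so the continuation
    starts from ranks one and two.\<close>
  ultimately have "extends_with_ranks 4 B C F (\<lambda>n. seq60 14 (Suc n))"
  proof (intro extends_with_ranks_Wagner)
    show "finite C" using C by (simp add: differential_step_def)
    show "seq60 14 (Suc (Suc (Suc n))) = int 4 * seq60 14 (Suc (Suc n)) + seq60 14 (Suc n)" for n
      by (cases n; cases "n - 1") auto
  qed (auto simp: B_def)
  then have "extends_with_ranks 4 A B E (seq60 14)"
    using C by (intro extends_with_ranks_step[of 4 A B E C F]) (auto simp: A_def)
  then show ?thesis
    unfolding A_def E_def by (rule extends_with_ranks_differential) (auto simp: B_def)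
qed

text \<open>Each near-pencil on five points costs three elements: 4 + 4 * 17 - 4 * 3 = 60 and 17 + 4
  * 60 - 3 = 254. The point is to place the apexes so that no surplus exceeds four.\<close>

lemma seq60_17_mem: "seq60 17 \<in> differential_rank_functions"
proof -
  define A :: "nat set" where "A = {0}"
  define B :: "nat set" where "B = {..<4}"
  define E :: "nat \<Rightarrow> nat \<Rightarrow> bool" where "E = (\<lambda>_ _. True)"
  have B: "finite B" "card B = 4" "B \<noteq> {}" by (auto simp: B_def lessThan_empty_iff)
  obtain C :: "nat set" and F where C: "differential_step 4 A B E C F" "card C = 17"
    and s: "\<And>y. y \<in> B \<Longrightarrow> \<exists>c\<in>C. {z \<in> B. F z c} = {y}"
    by (rule differential_step_Wagner[of A B E 4]) (auto simp: A_def B E_def)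
  have fC: "finite C" and CF: "\<And>c. c \<in> C \<Longrightarrow> \<exists>y\<in>B. F y c"
    using C(1) by (auto simp: differential_step_def)
  have up5: "card {c \<in> C. F y c} = 5" if "y \<in> B" for y
    using C(1) that by (simp add: differential_step_def A_def E_def)
  \<comment> \<open>The apex over \<open>y\<close> lies above no other atom, so no second
    near-pencil adds to its surplus.\<close>
  obtain a where a: "\<And>y. y \<in> B \<Longrightarrow> a y \<in> C \<and> {z \<in> B. F z (a y)} = {y}" using s by metis
  have ne: "{c \<in> C. F y c} \<noteq> {}" if "y \<in> B" for y
    using up5[OF that] by (metis card.empty zero_neq_numeral)
  define X where "X = (\<lambda>M F U a x y. if x \<in> M \<and> F x y then if y = a x then U x - 2 else 1 else 0 :: nat)"
  \<comment> \<open>At an apex the sum is 5 - 2 = 3; elsewhere each of the four atoms contributes at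
    most one.\<close>
  have X1: "(\<Sum>x\<in>B. if x \<in> B \<and> F x y then if y = a x then card {c \<in> C. F x c} - 2 else 1 else 0) \<le> 4"
    if "y \<in> C" for y
  proof (cases "\<exists>x\<in>B. y = a x")
    case True
    then obtain x where x: "x \<in> B" "y = a x" by blast
    have F: "F z y \<longleftrightarrow> z = x" if "z \<in> B" for z using a[OF x(1)] x(2) that by blast
    then show ?thesis using x up5 B(1) by (simp add: sum.remove[of B x] cong: if_cong)
  next
    case False
    then have "(\<Sum>x\<in>B. if x \<in> B \<and> F x y then if y = a x then card {c \<in> C. F x c} - 2 else 1 else 0)
        \<le> (\<Sum>x\<in>B. 1)" by (intro sum_mono) auto
    then show ?thesis by (simp add: B)
  qed
  obtain D :: "nat set" and G where D: "differential_step 4 B C F D G"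
    and cD: "card D + (\<Sum>x\<in>B. card {c \<in> C. F x c} - 2) = card B + 4 * card C"
  proof (rule differential_step_near_pencil[of B C F B a 4])
    show "a y \<in> {c \<in> C. F y c}" if "y \<in> B" for y using a[OF that] by blast
    show "card {c \<in> C. F y c} \<ge> 3" if "y \<in> B" for y using up5[OF that] by simp
  qed (rule B fC ne X1 subset_refl that | assumption)+
  have "card D = 60" using cD up5 by (simp add: B C)
  have fD: "finite D" using D by (simp add: differential_step_def)
  have upne: "{d \<in> D. G y d} \<noteq> {}" if "y \<in> C" for y
  proof -
    have "card {d \<in> D. G y d} > 0" using D that by (simp add: differential_step_def)
    then show ?thesis by (metis card.empty less_irrefl)
  qed
  obtain y0 where y0: "y0 \<in> B" using B(3) by blast
  \<comment> \<open>An element of rank two above a single atom has 1 + 4 = 5 upper covers, so its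
    near-pencil costs exactly three elements.\<close>
  define x0 where "x0 = a y0"
  have x0: "x0 \<in> C" "card {d \<in> D. G x0 d} = 5"
    using a[OF y0] D by (auto simp: x0_def differential_step_def)
  obtain d0 where d0: "d0 \<in> {d \<in> D. G x0 d}" using upne[OF x0(1)] by blast
  have X2: "(\<Sum>x\<in>C. if x \<in> {x0} \<and> G x y then if y = d0 then card {d \<in> D. G x d} - 2 else 1 else 0) \<le> 4"
    for y
    using fC x0 by (simp add: sum.remove[of C x0])
  obtain H :: "nat set" and I where H: "differential_step 4 C D G H I"
    and cH: "card H + (\<Sum>x\<in>{x0}. card {d \<in> D. G x d} - 2) = card C + 4 * card D"
  proof (rule differential_step_near_pencil[of C D G "{x0}" "\<lambda>_. d0" 4])
    show "d0 \<in> {d \<in> D. G x d}" "card {d \<in> D. G x d} \<ge> 3" if "x \<in> {x0}" for x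
      using d0 x0 that by auto
    show "{x0} \<subseteq> C" using x0 by simp
  qed (rule fC fD upne X2 that | assumption)+
  have "card H = 254" using cH x0(2) C(2) \<open>card D = 60\<close> by simp
  moreover have "{h \<in> H. I y h} \<noteq> {}" if "y \<in> D" for y
  proof -
    have "card {h \<in> H. I y h} > 0" using H that by (simp add: differential_step_def)
    then show ?thesis by (metis card.empty less_irrefl)
  qed
  moreover have "finite H" using H by (simp add: differential_step_def)
  ultimately have "extends_with_ranks 4 D H I (\<lambda>n. seq60 17 (Suc (Suc (Suc n))))"
    using fD \<open>card D = 60\<close> by (intro extends_with_ranks_Wagner) auto
  then have "extends_with_ranks 4 C D G (\<lambda>n. seq60 17 (Suc (Suc n)))"
    using C(2) by (intro extends_with_ranks_step[OF H]) auto
  then have "extends_with_ranks 4 B C F (\<lambda>n. seq60 17 (Suc n))"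
    using B by (intro extends_with_ranks_step[OF D]) auto
  then have "extends_with_ranks 4 A B E (seq60 17)"
    by (intro extends_with_ranks_step[OF C(1)]) (auto simp: A_def)
  then show ?thesis
    unfolding A_def E_def by (rule extends_with_ranks_differential) (auto simp: B)
qed

section \<open>Sixteen elements in rank two are impossible\<close>

text \<open>Let s be the size of a block. Double counting gives 20 for the sum of s and 12 for the
  sum of s (s - 1), so with 16 blocks the sum of (s - 1) (s - 2) is 12 - 40 + 32 = 4. Only blocks of
  size at least three contribute, there is at most one of them, and it contributes 2 or at least
  6.\<close>

lemma linear_space_on_4_points_card_neq_16:
  assumes A: "finite A" "card A = 4" and B: "finite B" and ne: "\<And>b. b \<in> B \<Longrightarrow> {a \<in> A. T b a} \<noteq> {}"
    and deg: "\<And>a. a \<in> A \<Longrightarrow> card {b \<in> B. T b a} = 5"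
    and pair: "\<And>a a'. \<lbrakk>a \<in> A; a' \<in> A; a \<noteq> a'\<rbrakk> \<Longrightarrow> card {b \<in> B. T b a \<and> T b a'} = 1"
  shows "card B \<noteq> 16"
proof
  assume cB: "card B = 16"
  define S where "S = (\<lambda>b. {a \<in> A. T b a})"
  \<comment> \<open>Sizes are integers because \<open>s b - 2\<close> is negative for
    singletons.\<close>
  define s where "s = (\<lambda>b. int (card (S b)))"
  have finS: "finite (S b)" for b using A by (simp add: S_def)
  have s1: "(\<Sum>b\<in>B. s b) = 20"
  proof -
    have "(\<Sum>b\<in>B. card (S b)) = (\<Sum>b\<in>B. \<Sum>a\<in>A. if T b a then 1 else 0)"
      using A by (simp add: S_def sum.If_cases Int_def)
    also have "\<dots> = (\<Sum>a\<in>A. \<Sum>b\<in>B. if T b a then 1 else 0)" by (rule sum.swap)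
    also have "\<dots> = (\<Sum>a\<in>A. card {b \<in> B. T b a})"
      using B by (simp add: sum.If_cases Int_def)
    also have "\<dots> = 20" using deg A by simp
    finally show ?thesis unfolding s_def by (metis of_nat_numeral of_nat_sum)
  qed
  \<comment> \<open>The ordered pairs of distinct points; there are 4 * 3 = 12, each in exactly one
    block.\<close>
  define D where "D = A \<times> A - Id"
  have finD: "finite D" using A by (simp add: D_def)
  have card_D: "card (W \<times> W - Id) = card W * (card W - 1)" if "finite W" for W :: "'a set"
  proof -
    have "card (W \<times> W - Id) = card (Sigma W (\<lambda>x. W - {x}))" by (rule arg_cong[of _ _ card]) auto
    also have "\<dots> = (\<Sum>x\<in>W. card W - 1)" using that by (subst card_SigmaI) auto
    finally show ?thesis by simp
  qed
  have s2: "(\<Sum>b\<in>B. s b * (s b - 1)) = 12"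
  proof -
    have "(\<Sum>b\<in>B. card (S b) * (card (S b) - 1)) = (\<Sum>b\<in>B. card (S b \<times> S b - Id))"
      using card_D finS by simp
    also have "\<dots> = (\<Sum>b\<in>B. card {p \<in> D. T b (fst p) \<and> T b (snd p)})"
      by (intro sum.cong arg_cong[of _ _ card]) (auto simp: S_def D_def)
    also have "\<dots> = (\<Sum>b\<in>B. \<Sum>p\<in>D. if T b (fst p) \<and> T b (snd p) then 1 else 0)"
      using finD by (simp add: sum.If_cases Int_def)
    also have "\<dots> = (\<Sum>p\<in>D. \<Sum>b\<in>B. if T b (fst p) \<and> T b (snd p) then 1 else 0)" by (rule sum.swap)
    also have "\<dots> = (\<Sum>p\<in>D. card {b \<in> B. T b (fst p) \<and> T b (snd p)})"
      using B by (simp add: sum.If_cases Int_def)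
    also have "\<dots> = (\<Sum>p\<in>D. 1)"
      by (intro sum.cong refl pair) (auto simp: D_def)
    also have "\<dots> = 12" using card_D[OF A(1)] A by (simp add: D_def)
    finally have "int (\<Sum>b\<in>B. card (S b) * (card (S b) - 1)) = 12" by simp
    moreover have "int (card (S b) * (card (S b) - 1)) = s b * (s b - 1)" if "b \<in> B" for b
      by (cases "card (S b)") (auto simp: s_def algebra_simps)
    ultimately show ?thesis by simp
  qed
  \<comment> \<open>This quadratic vanishes at the sizes one and two.\<close>
  have "(\<Sum>b\<in>B. (s b - 1) * (s b - 2)) = (\<Sum>b\<in>B. s b * (s b - 1) - 2 * s b + 2)"
    by (simp add: algebra_simps)
  also have "\<dots> = 4" using s1 s2 cB by (simp add: sum.distrib sum_subtractf sum_distrib_left[symmetric])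
  finally have s3: "(\<Sum>b\<in>B. (s b - 1) * (s b - 2)) = 4" .
  have s_pos: "s b \<ge> 1" if "b \<in> B" for b
  proof -
    have "card (S b) \<noteq> 0" using ne[OF that] finS[of b] by (simp add: S_def)
    then show ?thesis by (simp add: s_def)
  qed
  \<comment> \<open>Two blocks with at least three of the four points share at least 3 + 3 - 4 = 2
    points, and two points determine their block.\<close>
  have unique: "b = b'" if b: "b \<in> B" "b' \<in> B" "s b \<ge> 3" "s b' \<ge> 3" for b b'
  proof -
    have "card (S b \<union> S b') \<le> 4" 
      using A card_mono[OF A(1), of "S b \<union> S b'"] by (auto simp: S_def)
    moreover have "card (S b) + card (S b') = card (S b \<union> S b') + card (S b \<inter> S b')"
      using finS by (intro card_Un_Int) auto
    ultimately have "\<not> card (S b \<inter> S b') \<le> Suc 0" using b by (simp add: s_def)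
    then obtain a a' where a: "a \<in> S b \<inter> S b'" "a' \<in> S b \<inter> S b'" "a \<noteq> a'"
      using finS by (subst (asm) card_le_Suc0_iff_eq) auto
    then have "card {b \<in> B. T b a \<and> T b a'} = 1" by (intro pair) (auto simp: S_def)
    moreover have "b \<in> {b \<in> B. T b a \<and> T b a'}" "b' \<in> {b \<in> B. T b a \<and> T b a'}"
      using a b by (auto simp: S_def)
    ultimately show ?thesis by (metis (no_types, lifting) card_1_singletonE singletonD)
  qed
  have small: "(s b - 1) * (s b - 2) = 0" if "b \<in> B" "\<not> s b \<ge> 3" for b
    using s_pos[OF that(1)] that(2) by auto
  obtain b0 where b0: "b0 \<in> B" "s b0 \<ge> 3"
    using s3 small by (metis (no_types, lifting) sum.neutral zero_neq_numeral)
  have "(\<Sum>b\<in>B. (s b - 1) * (s b - 2)) = (s b0 - 1) * (s b0 - 2) + (\<Sum>b\<in>B - {b0}. (s b - 1) * (s b - 2))"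
    using b0 B by (simp add: sum.remove)
  also have "(\<Sum>b\<in>B - {b0}. (s b - 1) * (s b - 2)) = 0"
    using small unique b0 by (intro sum.neutral) blast
  finally have eq: "(s b0 - 1) * (s b0 - 2) = 4" using s3 by simp
  show False
  proof (cases "s b0 = 3")
    case False
    then have "(s b0 - 1) * (s b0 - 2) \<ge> 3 * 2" using b0(2) by (intro mult_mono) auto
    then show False using eq by simp
  qed (use eq in simp)
qed

text \<open>The bottom covers nothing, so its four upper covers force \<open>d = 4\<close>. Every
  atom covers the bottom only and hence has 1 + 4 upper covers; two atoms share the bottom and hence
  exactly one upper cover. The elements of rank two thus form the excluded linear space on the
  atoms.\<close>

lemma differential_poset_rank_2_neq_16:
  assumes D: "differential_poset d P r \<rho>" and "rank_sizes P \<rho> 1 = 4"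
  shows "rank_sizes P \<rho> 2 \<noteq> 16"
proof -
  define A where "A = {x \<in> P. \<rho> x = 1}"
  define B where "B = {x \<in> P. \<rho> x = 2}"
  have fin: "finite A" "finite B"
    unfolding A_def B_def using differential_poset_finite_rank[OF D] by auto
  have cA: "card A = 4" using assms(2) by (simp add: rank_sizes_def A_def)
  have gr: "\<And>x y. x \<in> P \<Longrightarrow> y \<in> P \<Longrightarrow> covers r x y \<Longrightarrow> \<rho> x = Suc (\<rho> y)"
    using D by (auto simp: differential_poset_def graded_by_def)
  have c1: "\<And>x y k. x \<in> P \<Longrightarrow> y \<in> P \<Longrightarrow> x \<noteq> y \<Longrightarrow>
        has_exactly {z \<in> P. covers r x z \<and> covers r y z} k \<longleftrightarrow>
        has_exactly {z \<in> P. covers r z x \<and> covers r z y} k"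
    and c2: "\<And>x m. x \<in> P \<Longrightarrow>
        has_exactly {z \<in> P. covers r x z} m \<longleftrightarrow> has_exactly {z \<in> P. covers r z x} (m + d)"
    using D unfolding differential_poset_def by blast+
  obtain v where v: "v \<in> P" "\<rho> v = 0" "\<And>x. x \<in> P \<Longrightarrow> \<rho> x = 0 \<Longrightarrow> x = v"
    using D unfolding differential_poset_def by blast
  have Av: "covers r a v" if "a \<in> A" for a
    using differential_poset_exists_covered[OF D, of a 0] that v(3) by (auto simp: A_def)
  have lowA: "z = v" if "a \<in> A" "z \<in> P" "covers r a z" for a z
    using gr[of a z] v(3)[of z] that by (auto simp: A_def)
  have "{z \<in> P. covers r v z} = {}" using gr[OF v(1)] v(2) by auto
  then have "has_exactly {z \<in> P. covers r v z} 0" by (simp only: has_exactly_def) simp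
  then have "has_exactly {z \<in> P. covers r z v} d" using c2[OF v(1), of 0] by simp
  moreover have "{z \<in> P. covers r z v} = A" using gr[OF _ v(1)] v(2) Av by (auto simp: A_def)
  ultimately have d: "d = 4" using cA by (simp add: has_exactly_def)
  have upA: "{z \<in> P. covers r z a \<and> T z} = {b \<in> B. covers r b a \<and> T b}" if "a \<in> A" for a T
    using gr[of _ a] that by (auto simp: A_def B_def)
  have "card B \<noteq> 16"
  proof (rule linear_space_on_4_points_card_neq_16[of A B "covers r"])
    show "{a \<in> A. covers r b a} \<noteq> {}" if "b \<in> B" for b
      using differential_poset_exists_covered[OF D, of b 1] that by (auto simp: A_def B_def)
    show "card {b \<in> B. covers r b a} = 5" if a: "a \<in> A" for a
    proof -
      have "{z \<in> P. covers r a z} = {v}" using Av lowA v(1) a by blast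
      then have "has_exactly {z \<in> P. covers r z a} 5"
        using c2[of a 1] a by (simp add: A_def has_exactly_def d)
      then show ?thesis using upA[OF a, of "\<lambda>_. True"] by (simp add: has_exactly_def)
    qed
    show "card {b \<in> B. covers r b a \<and> covers r b a'} = 1" if a: "a \<in> A" "a' \<in> A" "a \<noteq> a'" for a a'
    proof -
      have "{z \<in> P. covers r a z \<and> covers r a' z} = {v}" using Av lowA v(1) a by blast
      then have "has_exactly {z \<in> P. covers r z a \<and> covers r z a'} 1"
        using c1[of a a' 1] a by (simp add: A_def has_exactly_def)
      then show ?thesis using upA[OF a(1), of "\<lambda>z. covers r z a'"] by (simp add: has_exactly_def)
    qed
  qed (use fin cA in auto)
  then show ?thesis by (simp add: rank_sizes_def B_def)
qed

section \<open>Failure of the interval property\<close>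

text \<open>The recurrence starts at index five and reaches back only to index three, so the
  parameter never spreads beyond index two.\<close>

lemma seq60_eq_fun_upd: "seq60 c = (seq60 c')(2 := c)"
proof
  fix n
  have "n \<noteq> 2 \<Longrightarrow> seq60 c n = seq60 c' n"
    by (induction c n rule: seq60.induct) (auto simp: numeral_2_eq_2)
  then show "seq60 c n = ((seq60 c')(2 := c)) n" by (auto simp: seq60_values)
qed

theorem theorem9:
  shows "\<not> interval_property differential_rank_functions \<and>
    seq60 14 \<in> differential_rank_functions \<and>
    seq60 17 \<in> differential_rank_functions \<and>
    seq60 16 \<notin> differential_rank_functions"
proof -
  have no: "seq60 16 \<notin> differential_rank_functions"
  proof
    assume "seq60 16 \<in> differential_rank_functions"
    then obtain d r \<rho> and P :: "nat set" where D: "differential_poset d P r \<rho>"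
      and h: "seq60 16 = rank_sizes P \<rho>"
      unfolding differential_rank_functions_def by blast
    show False
      using differential_poset_rank_2_neq_16[OF D] seq60_values[of 16] unfolding h by simp
  qed
  have "\<not> interval_property differential_rank_functions"
  proof
    assume "interval_property differential_rank_functions"
    \<comment> \<open>The instance has index 2 and \<alpha> = 3, from 14 to 17; \<beta> = 2 will
      give 16.\<close>
    then have "(0 :: int) < 3 \<and> seq60 14 \<in> differential_rank_functions \<and>
        (seq60 14)(2 := seq60 14 2 + 3) \<in> differential_rank_functions \<longrightarrow>
        (\<forall>\<beta>\<in>{0..3}. (seq60 14)(2 := seq60 14 2 + \<beta>) \<in> differential_rank_functions)"
      unfolding interval_property_def by blast
    moreover have "(seq60 14)(2 := seq60 14 2 + 3) \<in> differential_rank_functions"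
      using seq60_17_mem seq60_eq_fun_upd[of 17 14] by (simp add: seq60_values)
    ultimately have "(seq60 14)(2 := seq60 14 2 + 2) \<in> differential_rank_functions"
      using seq60_14_mem by auto
    then show False using no seq60_eq_fun_upd[of 16 14] by (simp add: seq60_values)
  qed
  then show ?thesis using seq60_14_mem seq60_17_mem no by blast
qed

end
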